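(* For every real $r > \tfrac12$ there exist a positive integer $k = k(r)$, a real number $c = c(r) > 1$ and a function $\delta(d)$ with $\delta(d) \to 0$ as $d\to\infty$ such that for all $d$, $$ f_r(d) \ge \bigl(c + \delta(d)\bigr)^{d^{1/(2k)}}. $$
   Context: For $\Omega \subset \mathbb{R}^d$, $\operatorname{diam}\Omega = \sup_{x,y\in\Omega}|x-y|$ (Euclidean distance). $f(\Omega)$ denotes the minimum number $f$ such that $\Omega = \Omega_1\cup\dots\cup\Omega_f$ with $\operatorname{diam}\Omega_i < \operatorname{diam}\Omega$ for all $i$. $S_r^{d-1}\subset\mathbb{R}^d$ is the sphere of radius $r$ centred at the origin, and $f_r(d) = \max\{ f(\Omega) : \Omega \subset S_r^{d-1},\ \operatorname{diam}\Omega = 1\}$. *)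

theory Defs
  imports "HOL-Analysis.Analysis"
begin

definition Rd :: "nat \<Rightarrow> (nat \<Rightarrow> real) set" where
  "Rd d = {x. \<forall>i\<ge>d. x i = 0}"

definition edist :: "nat \<Rightarrow> (nat \<Rightarrow> real) \<Rightarrow> (nat \<Rightarrow> real) \<Rightarrow> real" where
  "edist d x y = sqrt (\<Sum>i<d. (x i - y i)^2)"

definition sphere_d :: "nat \<Rightarrow> real \<Rightarrow> (nat \<Rightarrow> real) set" where
  "sphere_d d r = {x \<in> Rd d. sqrt (\<Sum>i<d. (x i)^2) = r}"

text \<open>Diameter (supremum of pairwise Euclidean distances); same convention as
  the library's diameter for the empty set.\<close>
definition diam_d :: "nat \<Rightarrow> (nat \<Rightarrow> real) set \<Rightarrow> real" where
  "diam_d d S = (if S = {} then 0 else Sup {edist d x y | x y. x \<in> S \<and> y \<in> S})"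

definition borsuk_num :: "nat \<Rightarrow> (nat \<Rightarrow> real) set \<Rightarrow> nat" where
  "borsuk_num d \<Omega> = (LEAST n. \<exists>P :: nat \<Rightarrow> (nat \<Rightarrow> real) set.
       \<Omega> = (\<Union>i<n. P i) \<and> (\<forall>i<n. diam_d d (P i) < diam_d d \<Omega>))"

definition f_r :: "real \<Rightarrow> nat \<Rightarrow> nat" where
  "f_r r d = Sup {borsuk_num d \<Omega> | \<Omega>. \<Omega> \<subseteq> sphere_d d r \<and> diam_d d \<Omega> = 1}"

end

theory Submission
  imports Defs "HOL-Real_Asymp.Real_Asymp"
begin

text \<open>
  Take the vertices \<open>x\<close> of the cube \<open>{-1, 1}\<^sup>n\<close> with coordinate sum \<open>0\<close> and embed them by
  \<open>x \<mapsto> (\<alpha> x, \<beta> x\<^sup>\<otimes>\<^sup>B, const)\<close> with \<open>B\<close> even. Distances then depend on the normalised inner product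
  \<open>t\<close> through \<open>g t = t + a t\<^sup>B\<close>, and \<open>a\<close> is chosen so that the convex function \<open>g\<close> is minimal at
  \<open>t = - u\<close> with \<open>u = (B - 1) / (B + 1)\<close>. As \<open>B\<close> grows, \<open>g (- u) / g 1\<close> tends to \<open>- 1\<close>, so the
  image has circumradius close to half its diameter; the constant coordinate pushes it onto the
  sphere of radius \<open>r\<close>. With \<open>n = 2 (B + 1) L\<close>, a part of smaller diameter is a family of
  \<open>n/2\<close>-sets no two of which meet in exactly \<open>L\<close> points. When \<open>q = B L\<close> is a power of two, the
  Frankl--Wilson argument bounds such a family by the number of sets with fewer than \<open>q\<close> elements, which is
  exponentially smaller in \<open>L\<close> than \<open>n choose n/2\<close>. The dimension is about \<open>n\<^sup>B\<close>.
\<close>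

section \<open>Parity of binomial coefficients near powers of two\<close>

text \<open>By absorption, an odd value would be coprime to \<open>2 ^ a\<close> and would leave
  \<open>2 ^ a dvd j\<close>.\<close>

lemma even_binomial_two_power:
  assumes "0 < j" "j < 2 ^ a"
  shows "even ((2 ^ a :: nat) choose j)"
proof (rule ccontr)
  assume odd: "odd ((2 ^ a :: nat) choose j)"
  have "j * (2 ^ a choose j) = 2 ^ a * ((2 ^ a - 1) choose (j - 1))"
    using assms(1) by (rule times_binomial_minus1_eq)
  then have "2 ^ a dvd j * (2 ^ a choose j)" by simp
  moreover have "coprime (2 ^ a) (2 ^ a choose j)" using odd by simp
  ultimately have "2 ^ a dvd j" using coprime_dvd_mult_left_iff by blast
  with assms show False using dvd_imp_le by fastforce
qed

text \<open>Apply Vandermonde to \<open>m = 2 ^ a + m'\<close>: the term \<open>j = 0\<close>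
  vanishes because \<open>m' < 2 ^ a - 1\<close>, and every other term has the even factor
  \<open>2 ^ a choose j\<close>. Together with the next lemma, up to \<open>2 * 2 ^ a - 1\<close>
  only the arguments \<open>2 ^ a - 1\<close> and \<open>2 * 2 ^ a - 1\<close> give odd
  values.\<close>

lemma even_binomial_two_power_pred:
  assumes "m < 2 * 2 ^ a - 1" "m \<noteq> 2 ^ a - 1"
  shows "even (m choose (2 ^ a - 1))"
proof (cases "m < 2 ^ a - 1")
  case False
  define m' where "m' = m - 2 ^ a"
  have m: "m = 2 ^ a + m'" and m': "m' < 2 ^ a - 1" using False assms by (auto simp: m'_def)
  have "even ((2 ^ a choose j) * (m' choose (2 ^ a - 1 - j)))" if "j \<le> 2 ^ a - 1" for j
  proof (cases "j = 0")
    case False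
    have "(0::nat) < 2 ^ a" by simp
    with that have "j < 2 ^ a" by linarith
    with False even_binomial_two_power[of j a] show ?thesis by simp
  qed (use m' in \<open>simp add: binomial_eq_0\<close>)
  then have "even (\<Sum>j\<le>2 ^ a - 1. (2 ^ a choose j) * (m' choose (2 ^ a - 1 - j)))"
    by (intro dvd_sum) simp
  then show ?thesis by (simp only: vandermonde m)
next
  case True
  then have "m choose (2 ^ a - 1) = 0" by (rule binomial_eq_0)
  then show ?thesis by (simp only: dvd_0_right)
qed

text \<open>In the Vandermonde expansion for \<open>q + (q - 1)\<close> only the term
  \<open>j = 0\<close> is odd.\<close>

lemma odd_binomial_two_power_pred: "odd ((2 * 2 ^ a - 1) choose (2 ^ a - 1))"
proof -
  let ?q = "2 ^ a :: nat"
  have q: "0 < ?q" by simp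
  have "even ((?q choose j) * ((?q - 1) choose (?q - 1 - j)))" if "j \<in> {..?q - 1} - {0}" for j
  proof -
    have "j < ?q" using that q by (auto simp del: zero_less_power)
    then show ?thesis using that even_binomial_two_power[of j a] by simp
  qed
  then have "even (\<Sum>j\<in>{..?q - 1} - {0}. (?q choose j) * ((?q - 1) choose (?q - 1 - j)))"
    by (intro dvd_sum)
  moreover have "(\<Sum>j\<le>?q - 1. (?q choose j) * ((?q - 1) choose (?q - 1 - j)))
      = 1 + (\<Sum>j\<in>{..?q - 1} - {0}. (?q choose j) * ((?q - 1) choose (?q - 1 - j)))"
    by (subst sum.remove[of _ 0]) auto
  ultimately have "odd ((?q + (?q - 1)) choose (?q - 1))" by (simp only: vandermonde[symmetric]) simp
  moreover have "?q + (?q - 1) = 2 * ?q - 1" using q by linarith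
  ultimately show ?thesis by metis
qed

section \<open>Set families with one forbidden intersection size\<close>

text \<open>For \<open>X = A \<inter> B\<close> the indicator on the left is a product of one for
  \<open>A\<close> and one for \<open>B\<close>; this is what factors a matrix of binomials in
  \<open>card (A \<inter> B)\<close> through the small subsets.\<close>

lemma sum_small_subsets:
  fixes w :: "nat \<Rightarrow> nat"
  assumes "finite U" "X \<subseteq> U"
  shows "(\<Sum>S | S \<subseteq> U \<and> card S < q. w (card S) * of_bool (S \<subseteq> X)) = (\<Sum>j<q. w j * (card X choose j))"
proof -
  have fX: "finite X" using assms finite_subset by blast
  have "(\<Sum>S | S \<subseteq> U \<and> card S < q. w (card S) * of_bool (S \<subseteq> X))
      = (\<Sum>S | S \<subseteq> X \<and> card S < q. w (card S))"
    using assms by (intro sum.mono_neutral_cong_right) (auto simp: rev_finite_subset)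
  also have "\<dots> = (\<Sum>j<q. \<Sum>S | S \<in> {S. S \<subseteq> X \<and> card S < q} \<and> card S = j. w (card S))"
    using fX by (intro sum.group[symmetric]) auto
  also have "\<dots> = (\<Sum>j<q. w j * (card X choose j))"
  proof (intro sum.cong refl)
    fix j assume "j \<in> {..<q}"
    then have "{S. S \<in> {S. S \<subseteq> X \<and> card S < q} \<and> card S = j} = {S. S \<subseteq> X \<and> card S = j}" by auto
    then show "(\<Sum>S | S \<in> {S. S \<subseteq> X \<and> card S < q} \<and> card S = j. w (card S)) = w j * (card X choose j)"
      using n_subsets[OF fX, of j] by simp
  qed
  finally show ?thesis .
qed

text \<open>Distinct members meet in fewer than \<open>q + l\<close> points and never in
  \<open>l\<close>, so modulo \<open>q\<close> the size \<open>l\<close> occurs only on the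
  diagonal.\<close>

lemma forbidden_intersection_bound:
  fixes U :: "'a set"
  assumes U: "finite U" and q: "q = 2 ^ a" and l: "l < q"
    and F: "\<And>A. A \<in> F \<Longrightarrow> A \<subseteq> U \<and> card A = q + l"
    and avoid: "\<And>A B. A \<in> F \<Longrightarrow> B \<in> F \<Longrightarrow> card (A \<inter> B) \<noteq> l"
  shows "card F \<le> (\<Sum>j<q. card U choose j)"
proof -
  define T where "T = {S. S \<subseteq> U \<and> card S < q}"
  define w where "w j = (q - 1 - l) choose (q - 1 - j)" for j
  \<comment> \<open>The shift by \<open>q - 1 - l\<close> sends the forbidden size \<open>l\<close>
    to \<open>q - 1\<close> and the diagonal size \<open>q + l\<close> to \<open>2 * q - 1\<close>,
    the only two places where the binomial is odd.\<close>
  define M where "M A B = (card (A \<inter> B) + (q - 1 - l)) choose (q - 1)" for A B :: "'a set"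
  \<comment> \<open>The mod 2 sum of the incidence vectors of the members of \<open>G\<close>,
    recorded as its support in \<open>T\<close>.\<close>
  define \<Phi> where "\<Phi> G = {S \<in> T. odd (card {A \<in> G. S \<subseteq> A})}" for G
  have finT: "finite T" using U by (simp add: T_def)
  have finF: "finite F" using F U by (meson Pow_iff finite_Pow_iff finite_subset subsetI)
  have qpos: "0 < q" using q by simp
  have M_sum: "M A B = (\<Sum>S\<in>T. w (card S) * of_bool (S \<subseteq> A \<and> S \<subseteq> B))" if "A \<in> F" "B \<in> F" for A B
  proof -
    have "M A B = (\<Sum>j\<le>q - 1. (card (A \<inter> B) choose j) * ((q - 1 - l) choose (q - 1 - j)))"
      unfolding M_def by (rule vandermonde[symmetric])
    also have "{..q - 1} = {..<q}" using qpos by auto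
    also have "(\<Sum>j<q. (card (A \<inter> B) choose j) * ((q - 1 - l) choose (q - 1 - j)))
        = (\<Sum>S\<in>T. w (card S) * of_bool (S \<subseteq> A \<inter> B))"
      unfolding T_def w_def using F[OF that(1)] U
      by (subst sum_small_subsets) (auto simp: mult.commute)
    finally show ?thesis by simp
  qed
  have M_diag: "odd (M A A)" if "A \<in> F" for A
  proof -
    have "card (A \<inter> A) + (q - 1 - l) = 2 * 2 ^ a - 1" using F[OF that] l q by simp
    then show ?thesis unfolding M_def q using odd_binomial_two_power_pred[of a] by metis
  qed
  have M_off: "even (M A B)" if "A \<in> F" "B \<in> F" "A \<noteq> B" for A B
  proof -
    have fin: "finite A" "finite B" using F that U finite_subset by blast+
    have "card (A \<inter> B) \<noteq> card A"
    proof
      assume "card (A \<inter> B) = card A"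
      then have "A \<inter> B = A" using fin by (metis card_subset_eq Int_lower1)
      then have "A \<subseteq> B" by blast
      then have "A = B" using F that fin by (metis card_subset_eq)
      with that show False by simp
    qed
    then have "card (A \<inter> B) < q + l" using F[OF that(1)] fin
      by (metis card_mono Int_lower1 le_neq_implies_less)
    then show ?thesis unfolding M_def q
      using avoid[OF that(1,2)] l q by (intro even_binomial_two_power_pred) auto
  qed
  \<comment> \<open>\<open>M\<close> is the identity mod 2 and factors through \<open>T\<close>, so the incidence vectors of the members of \<open>F\<close>
      with \<open>T\<close> are independent over the field with two elements; counting subset sums replaces the rank.\<close>
  have inj: "inj_on \<Phi> (Pow F)"
  proof (rule inj_onI, rule ccontr)
    fix G H assume GH: "G \<in> Pow F" "H \<in> Pow F" "\<Phi> G = \<Phi> H" "G \<noteq> H"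
    have finGH: "finite G" "finite H" using GH finF finite_subset by blast+
    \<comment> \<open>Common members cancel mod 2, so the incidence vectors of the members of
      \<open>D\<close> sum to zero.\<close>
    define D where "D = (G - H) \<union> (H - G)"
    have D: "D \<subseteq> F" "finite D" "D \<noteq> {}" using GH finGH by (auto simp: D_def)
    have ev: "even (card {A \<in> D. S \<subseteq> A})" if "S \<in> T" for S
    proof -
      let ?g = "{A \<in> G. S \<subseteq> A}" and ?h = "{A \<in> H. S \<subseteq> A}"
      have cd: "even (a + b)" if "odd x = odd y" "x = a + c" "y = b + c" for a b c x y :: nat
        using that by auto
      have "odd (card ?g) = odd (card ?h)"
        using GH(3) that unfolding \<Phi>_def by blast
      moreover have "card ?g = card (?g - ?h) + card (?g \<inter> ?h)"
        using finGH by (subst card_Un_disjoint[symmetric]) (auto intro!: arg_cong[where f=card])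
      moreover have "card ?h = card (?h - ?g) + card (?g \<inter> ?h)"
        using finGH by (subst card_Un_disjoint[symmetric]) (auto intro!: arg_cong[where f=card])
      ultimately have "even (card (?g - ?h) + card (?h - ?g))" by (rule cd)
      moreover have "card {A \<in> D. S \<subseteq> A} = card (?g - ?h) + card (?h - ?g)"
        using finGH by (subst card_Un_disjoint[symmetric]) (auto intro!: arg_cong[where f=card] simp: D_def)
      ultimately show ?thesis by simp
    qed
    obtain A0 where A0: "A0 \<in> D" using D by blast
    \<comment> \<open>Pairing the vanishing sum with \<open>A0\<close> through the factorisation
      makes this sum even, yet \<open>M A0 A0\<close> is its only odd term.\<close>
    have "(\<Sum>A\<in>D. M A A0) = (\<Sum>A\<in>D. \<Sum>S\<in>T. w (card S) * of_bool (S \<subseteq> A0) * of_bool (S \<subseteq> A))"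
      using A0 D(1) by (intro sum.cong) (auto simp: M_sum subset_iff intro!: sum.cong)
    also have "\<dots> = (\<Sum>S\<in>T. w (card S) * of_bool (S \<subseteq> A0) * (\<Sum>A\<in>D. of_bool (S \<subseteq> A)))"
      by (subst sum.swap) (simp only: sum_distrib_left)
    also have "\<dots> = (\<Sum>S\<in>T. w (card S) * of_bool (S \<subseteq> A0) * card {A \<in> D. S \<subseteq> A})"
      using D(2) by (simp add: sum_of_bool_eq Int_def)
    finally have "even (\<Sum>A\<in>D. M A A0)" using ev by (auto intro!: dvd_sum)
    moreover have "(\<Sum>A\<in>D. M A A0) = M A0 A0 + (\<Sum>A\<in>D - {A0}. M A A0)"
      using D A0 by (simp add: sum.remove)
    moreover have "even (\<Sum>A\<in>D - {A0}. M A A0)"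
      using D A0 by (intro dvd_sum M_off) auto
    ultimately show False using M_diag A0 D by auto
  qed
  have "card (Pow F) \<le> card (Pow T)"
    using finT by (intro card_inj_on_le[OF inj]) (auto simp: \<Phi>_def)
  then have "card F \<le> card T" using finF finT by (simp add: card_Pow)
  also have "card T = (\<Sum>j<q. card U choose j)"
    using sum_small_subsets[OF U order.refl, of "\<lambda>_. 1" q] by (simp add: T_def[symmetric]) (simp add: T_def)
  finally show ?thesis .
qed

section \<open>Exponential gap between the middle binomial coefficient and the lower tail\<close>

text \<open>The tail is at most \<open>(1 + x) ^ (2 * k) / x ^ (B * L)\<close> by the generating
  function, and the middle coefficient is at least \<open>4 ^ k / (2 * k)\<close>; the quotient is
  \<open>\<gamma> ^ L / (2 * k)\<close> at the optimal \<open>x\<close>.\<close>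

lemma central_binomial_ratio:
  fixes B L :: nat
  assumes "B > 0" "L > 0"
  defines "\<gamma> \<equiv> (real B + 2) ^ (B + 2) * real B ^ B / (real B + 1) ^ (2 * B + 2)"
  shows "\<gamma> ^ L / real (2 * (B + 1) * L) * real (\<Sum>j<B * L. 2 * (B + 1) * L choose j)
     \<le> real (2 * (B + 1) * L choose ((B + 1) * L))"
proof -
  \<comment> \<open>Minimises \<open>(1 + x)\<^bsup>2k\<^esup> / x\<^bsup>BL\<^esup>\<close>.\<close>
  define x where "x = real B / (real B + 2)"
  define k where "k = (B + 1) * L"
  have x: "0 < x" "x \<le> 1" using assms by (auto simp: x_def)
  have k: "k > 0" using assms by (simp add: k_def)
  have "real (\<Sum>j<B * L. 2 * k choose j) * x ^ (B * L) = (\<Sum>j<B * L. real (2 * k choose j) * x ^ (B * L))"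
    by (simp add: sum_distrib_right)
  also have "\<dots> \<le> (\<Sum>j<B * L. real (2 * k choose j) * x ^ j)"
    using x by (intro sum_mono mult_left_mono power_decreasing) auto
  also have "\<dots> \<le> (\<Sum>j\<le>2 * k. real (2 * k choose j) * x ^ j)"
    using x by (intro sum_mono2) (auto simp: k_def)
  also have "\<dots> = (1 + x) ^ (2 * k)"
    by (subst add.commute) (simp add: binomial_ring[of x 1])
  finally have A: "real (\<Sum>j<B * L. 2 * k choose j) * x ^ (B * L) \<le> (1 + x) ^ (2 * k)" .
  have g: "\<gamma> = 4 ^ (B + 1) * x ^ B / (1 + x) ^ (2 * (B + 1))"
  proof -
    define y w where "y = real B + 2" and "w = real B + 1"
    have yw: "y > 0" "w > 0" by (auto simp: y_def w_def)
    have "1 + x = 2 * w / y" by (simp add: x_def y_def w_def field_simps)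
    then have "(1 + x) ^ (2 * (B + 1)) = 4 ^ (B + 1) * w ^ (2 * B + 2) / (y ^ (B + 2) * y ^ B)"
      by (simp add: power_divide power_mult_distrib power_mult flip: power_add)
        (simp add: power_add power_mult power2_eq_square power_mult_distrib mult_ac)
    moreover have "\<gamma> = y ^ (B + 2) * real B ^ B / w ^ (2 * B + 2)" by (simp add: \<gamma>_def y_def w_def)
    moreover have "x ^ B = real B ^ B / y ^ B" by (simp add: x_def y_def power_divide)
    ultimately show ?thesis using yw by simp
  qed
  have "\<gamma> ^ L = 4 ^ k * x ^ (B * L) / (1 + x) ^ (2 * k)"
    unfolding g k_def by (simp only: power_divide power_mult_distrib power_mult[symmetric] mult.assoc)
  then have "\<gamma> ^ L / real (2 * k) * real (\<Sum>j<B * L. 2 * k choose j) =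
     4 ^ k / real (2 * k) * (real (\<Sum>j<B * L. 2 * k choose j) * x ^ (B * L) / (1 + x) ^ (2 * k))"
    by (simp only: times_divide_eq_left times_divide_eq_right mult_ac divide_divide_eq_left)
  also have "\<dots> \<le> 4 ^ k / real (2 * k) * 1"
    using A x by (intro mult_left_mono) auto
  also have "\<dots> \<le> real (2 * k choose k)"
    using central_binomial_lower_bound[OF k] by simp
  finally show ?thesis by (simp only: k_def mult.assoc)
qed

text \<open>With \<open>z = B + 1\<close> the expression is
  \<open>(1 + 1 / z)^2 * (1 - 1 / z^2) ^ B\<close>, and Bernoulli bounds it below by
  \<open>1 + (z^3 + z + 1) / z^4\<close>.\<close>

lemma growth_rate_gt_1:
  fixes B :: nat
  shows "(real B + 2) ^ (B + 2) * real B ^ B / (real B + 1) ^ (2 * B + 2) > 1"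
proof -
  define z where "z = real B + 1"
  have z: "z \<ge> 1" by (simp add: z_def)
  have bern: "1 + real B * (- 1 / z\<^sup>2) \<le> (1 + (- 1 / z\<^sup>2)) ^ B"
    using z by (intro Bernoulli_inequality) (simp add: field_simps)
  have "1 < (1 + 1 / z)\<^sup>2 * (1 - real B / z\<^sup>2)"
  proof -
    have B: "real B = z - 1" by (simp add: z_def)
    have "(1 + 1 / z)\<^sup>2 * (1 - real B / z\<^sup>2) = 1 + (z ^ 3 + z + 1) / z ^ 4"
      unfolding B using z by (simp add: divide_simps) (simp add: algebra_simps power_numeral_reduce)
    moreover have "(z ^ 3 + z + 1) / z ^ 4 > 0" using z by (intro divide_pos_pos add_nonneg_pos) auto
    ultimately show ?thesis by linarith
  qed
  also have "\<dots> \<le> (1 + 1 / z)\<^sup>2 * (1 - 1 / z\<^sup>2) ^ B"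
    using bern by (intro mult_left_mono) auto
  also have "(1 + 1 / z)\<^sup>2 * (1 - 1 / z\<^sup>2) ^ B
      = (real B + 2) ^ (B + 2) * real B ^ B / (real B + 1) ^ (2 * B + 2)"
  proof -
    define y where "y = real B + 2"
    have "1 - 1 / z\<^sup>2 = (z + 1) * (z - 1) / z\<^sup>2" using z
      by (simp add: divide_simps) (simp add: algebra_simps power2_eq_square)
    then have "1 - 1 / z\<^sup>2 = y * real B / z\<^sup>2" by (simp add: z_def y_def algebra_simps)
    then have "(1 - 1 / z\<^sup>2) ^ B = y ^ B * real B ^ B / z ^ (2 * B)"
      by (simp add: power_divide power_mult_distrib power_mult)
    moreover have "(1 + 1 / z)\<^sup>2 = y\<^sup>2 / z\<^sup>2"
      using z by (simp add: z_def y_def field_simps power2_eq_square)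
    ultimately have "(1 + 1 / z)\<^sup>2 * (1 - 1 / z\<^sup>2) ^ B = y ^ (B + 2) * real B ^ B / z ^ (2 * B + 2)"
      by (simp only: power_add times_divide_times_eq mult_ac)
    then show ?thesis by (simp only: y_def z_def)
  qed
  finally show ?thesis .
qed

section \<open>Diameters and Borsuk numbers on a sphere\<close>

lemma edist_le:
  assumes "\<And>i. i < d \<Longrightarrow> \<bar>x i - y i\<bar> \<le> e" "0 \<le> e"
  shows "edist d x y \<le> sqrt (real d) * e"
proof -
  have "(x i - y i)\<^sup>2 \<le> e\<^sup>2" if "i < d" for i
    using assms that by (simp add: abs_le_square_iff[symmetric])
  then have "(\<Sum>i<d. (x i - y i)\<^sup>2) \<le> (\<Sum>i<d. e\<^sup>2)" by (intro sum_mono) auto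
  then have "edist d x y \<le> sqrt (real d * e\<^sup>2)" unfolding edist_def by (intro real_sqrt_le_mono) simp
  then show ?thesis using assms(2) by (simp add: real_sqrt_mult)
qed

lemma diam_d_le:
  assumes "\<And>x y. x \<in> S \<Longrightarrow> y \<in> S \<Longrightarrow> edist d x y \<le> D" "0 \<le> D"
  shows "diam_d d S \<le> D"
proof (cases "S = {}")
  case False
  then have "{edist d x y | x y. x \<in> S \<and> y \<in> S} \<noteq> {}" by blast
  then have "Sup {edist d x y | x y. x \<in> S \<and> y \<in> S} \<le> D"
    by (rule cSup_least) (use assms(1) in blast)
  then show ?thesis using False by (simp add: diam_d_def)
qed (simp add: diam_d_def assms(2))

text \<open>The bound \<open>D\<close> makes the set of distances bounded above, so that the real
  \<open>Sup\<close> is a genuine supremum.\<close>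

lemma edist_le_diam_d:
  assumes "x \<in> S" "y \<in> S" "\<And>x y. x \<in> S \<Longrightarrow> y \<in> S \<Longrightarrow> edist d x y \<le> D"
  shows "edist d x y \<le> diam_d d S"
proof -
  have "bdd_above {edist d x y | x y. x \<in> S \<and> y \<in> S}" using assms(3) by (auto intro!: bdd_aboveI)
  then show ?thesis using assms(1,2) unfolding diam_d_def by (auto intro!: cSup_upper)
qed

text \<open>Finitely many grid cells of side \<open>1 / s\<close> cover the sphere, each of diameter
  at most \<open>sqrt d / s < 1\<close>. The existence of a partition gives meaning to the
  \<open>LEAST\<close> in \<open>borsuk_num\<close>, and the uniformity of \<open>N\<close> to the
  \<open>Sup\<close> in \<open>f_r\<close>.\<close>

lemma sphere_partition_bound:
  "\<exists>N :: nat. \<forall>\<Omega> \<subseteq> sphere_d d r. \<exists>P. \<Omega> = (\<Union>i<N. P i) \<and> (\<forall>i<N. diam_d d (P i) < 1)"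
proof -
  \<comment> \<open>The summand 1 gives \<open>sqrt d < s\<close> and keeps \<open>s\<close>
    positive for \<open>d = 0\<close>.\<close>
  define s where "s = sqrt (real d) + 1"
  define K where "K = \<lceil>\<bar>r\<bar> * s\<rceil> + 1"
  define c where "c x = (\<lambda>i\<in>{..<d}. \<lfloor>x i * s\<rfloor>)" for x :: "nat \<Rightarrow> real"
  define C where "C = PiE {..<d} (\<lambda>_. {- K..K})"
  have s: "s \<ge> 1" "sqrt (real d) < s" by (auto simp: s_def)
  have "finite C" by (auto simp: C_def intro!: finite_PiE)
  then obtain h where h: "bij_betw h {..<card C} C" using ex_bij_betw_nat_finite atLeast0LessThan by metis
  have cC: "c x \<in> C" if "x \<in> sphere_d d r" for x
    unfolding C_def
  proof (rule PiE_I)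
    fix i assume i: "i \<in> {..<d}"
    have "(x i)\<^sup>2 \<le> (\<Sum>i<d. (x i)\<^sup>2)" using i by (intro member_le_sum) auto
    then have "\<bar>x i\<bar> \<le> sqrt (\<Sum>i<d. (x i)\<^sup>2)" using real_le_rsqrt by fastforce
    then have "\<bar>x i\<bar> \<le> \<bar>r\<bar>" using that by (auto simp: sphere_d_def)
    then have "\<bar>x i * s\<bar> \<le> \<bar>r\<bar> * s" using s by (auto simp: abs_mult intro!: mult_mono)
    then have "\<lfloor>x i * s\<rfloor> \<in> {- K..K}" unfolding K_def by simp linarith
    then show "c x i \<in> {- K..K}" using i by (simp add: c_def)
  qed (simp add: c_def)
  show ?thesis
  proof (intro exI[of _ "card C"] allI impI)
    fix \<Omega> assume \<Omega>: "\<Omega> \<subseteq> sphere_d d r"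
    define P where "P j = {x \<in> \<Omega>. c x = h j}" for j
    have "\<Omega> = (\<Union>j<card C. P j)"
    proof
      show "\<Omega> \<subseteq> (\<Union>j<card C. P j)"
      proof
        fix x assume x: "x \<in> \<Omega>"
        then have "c x \<in> h ` {..<card C}" using cC \<Omega> h by (auto simp: bij_betw_def)
        then show "x \<in> (\<Union>j<card C. P j)" using x by (auto simp: P_def)
      qed
    qed (auto simp: P_def)
    moreover have "diam_d d (P j) < 1" for j
    proof -
      have "diam_d d (P j) \<le> sqrt (real d) * (1 / s)"
      proof (intro diam_d_le edist_le)
        fix x y i assume xy: "x \<in> P j" "y \<in> P j" "i < d"
        then have "c x i = c y i" by (simp add: P_def)
        then have "\<lfloor>x i * s\<rfloor> = \<lfloor>y i * s\<rfloor>" using xy(3) by (simp add: c_def)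
        then have "\<bar>x i * s - y i * s\<bar> \<le> 1" by linarith
        then have "\<bar>x i - y i\<bar> * s \<le> 1" using s by (simp add: abs_mult flip: left_diff_distrib)
        then show "\<bar>x i - y i\<bar> \<le> 1 / s" using s by (simp add: field_simps)
      qed (use s in auto)
      also have "\<dots> < 1" using s by simp
      finally show ?thesis .
    qed
    ultimately show "\<exists>P. \<Omega> = (\<Union>i<card C. P i) \<and> (\<forall>i<card C. diam_d d (P i) < 1)" by blast
  qed
qed

lemma borsuk_num_le_f_r:
  assumes "\<Omega> \<subseteq> sphere_d d r" "diam_d d \<Omega> = 1"
  shows "borsuk_num d \<Omega> \<le> f_r r d"
proof -
  obtain N :: nat where N: "\<And>\<Omega>. \<Omega> \<subseteq> sphere_d d r \<Longrightarrow> \<exists>P. \<Omega> = (\<Union>i<N. P i) \<and> (\<forall>i<N. diam_d d (P i) < 1)"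
    using sphere_partition_bound[of d r] by blast
  have "borsuk_num d \<Omega>' \<le> N" if "\<Omega>' \<subseteq> sphere_d d r" "diam_d d \<Omega>' = 1" for \<Omega>'
    unfolding borsuk_num_def by (rule Least_le) (use N[OF that(1)] that(2) in simp)
  then have "bdd_above {borsuk_num d \<Omega> | \<Omega>. \<Omega> \<subseteq> sphere_d d r \<and> diam_d d \<Omega> = 1}"
    by (auto intro!: bdd_aboveI[of _ N])
  then show ?thesis unfolding f_r_def using assms by (intro cSup_upper) auto
qed

lemma borsuk_num_partition:
  assumes "\<Omega> \<subseteq> sphere_d d r" "diam_d d \<Omega> = 1"
  obtains P where "\<Omega> = (\<Union>i<borsuk_num d \<Omega>. P i)" "\<And>i. i < borsuk_num d \<Omega> \<Longrightarrow> diam_d d (P i) < 1"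
proof -
  define Q where "Q N \<longleftrightarrow> (\<exists>P. \<Omega> = (\<Union>i<N. P i) \<and> (\<forall>i<N. diam_d d (P i) < diam_d d \<Omega>))" for N :: nat
  obtain N where "Q N"
    using sphere_partition_bound[of d r] assms(1) unfolding Q_def assms(2) by blast
  then have "Q (Least Q)" by (rule LeastI)
  then have "Q (borsuk_num d \<Omega>)" unfolding borsuk_num_def Q_def[abs_def] .
  then obtain P where "\<Omega> = (\<Union>i<borsuk_num d \<Omega>. P i)"
      "\<forall>i<borsuk_num d \<Omega>. diam_d d (P i) < diam_d d \<Omega>"
    unfolding Q_def by blast
  then show ?thesis using that unfolding assms(2) by blast
qed

text \<open>A part of diameter below 1 pulls back to a subfamily with no pair at distance 1, hence
  of size at most \<open>D\<close>. Preimages in \<open>X\<close> are counted, so coinciding images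
  do no harm.\<close>

lemma card_le_borsuk_num_mult:
  fixes \<phi> :: "'a \<Rightarrow> nat \<Rightarrow> real"
  assumes fin: "finite X" and sph: "\<phi> ` X \<subseteq> sphere_d d r"
    and le1: "\<And>A B. A \<in> X \<Longrightarrow> B \<in> X \<Longrightarrow> edist d (\<phi> A) (\<phi> B) \<le> 1"
    and ex1: "A \<in> X" "B \<in> X" "edist d (\<phi> A) (\<phi> B) = 1"
    and bound: "\<And>F. F \<subseteq> X \<Longrightarrow> (\<And>A B. A \<in> F \<Longrightarrow> B \<in> F \<Longrightarrow> edist d (\<phi> A) (\<phi> B) \<noteq> 1) \<Longrightarrow> card F \<le> D"
  shows "card X \<le> f_r r d * D"
proof -
  let ?\<Omega> = "\<phi> ` X"
  have le: "edist d x y \<le> 1" if "x \<in> ?\<Omega>" "y \<in> ?\<Omega>" for x y using le1 that by auto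
  have dia: "diam_d d ?\<Omega> = 1"
  proof (rule antisym)
    show "1 \<le> diam_d d ?\<Omega>"
      using edist_le_diam_d[of "\<phi> A" ?\<Omega> "\<phi> B" d 1, OF _ _ le] ex1 by simp
  qed (use le in \<open>auto intro!: diam_d_le\<close>)
  obtain P where P: "?\<Omega> = (\<Union>i<borsuk_num d ?\<Omega>. P i)"
      "\<And>i. i < borsuk_num d ?\<Omega> \<Longrightarrow> diam_d d (P i) < 1"
    using borsuk_num_partition[OF sph dia] by blast
  define F where "F i = {A \<in> X. \<phi> A \<in> P i}" for i
  have FD: "card (F i) \<le> D" if i: "i < borsuk_num d ?\<Omega>" for i
  proof (rule bound)
    fix A B assume AB: "A \<in> F i" "B \<in> F i"
    have "P i \<subseteq> ?\<Omega>" using P(1) i by blast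
    then have "edist d (\<phi> A) (\<phi> B) \<le> diam_d d (P i)"
      using AB le by (intro edist_le_diam_d[where D = 1]) (auto simp: F_def subset_iff)
    then show "edist d (\<phi> A) (\<phi> B) \<noteq> 1" using P(2)[OF i] by linarith
  qed (auto simp: F_def)
  have "X = (\<Union>i<borsuk_num d ?\<Omega>. F i)"
    using P(1) by (auto simp: F_def)
  then have "card X \<le> (\<Sum>i<borsuk_num d ?\<Omega>. card (F i))"
    using card_UN_le[of "{..<borsuk_num d ?\<Omega>}" F] by simp
  also have "\<dots> \<le> (\<Sum>i<borsuk_num d ?\<Omega>. D)" using FD by (intro sum_mono) auto
  also have "\<dots> \<le> f_r r d * D" using borsuk_num_le_f_r[OF sph dia] by simp
  finally show ?thesis .
qed

section \<open>The tensor power embedding\<close>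

text \<open>The base \<open>n\<close> digits of \<open>i < n ^ m\<close> run over all strings of
  length \<open>m\<close>, so this is the expanded power; the induction splits off the lowest digit.
  With \<open>z i = x i * y i\<close> it computes inner products of \<open>m\<close>-th tensor
  powers.\<close>

lemma sum_tensor_power:
  fixes z :: "nat \<Rightarrow> real"
  shows "(\<Sum>i<n ^ m. \<Prod>j<m. z (i div n ^ j mod n)) = (\<Sum>i<n. z i) ^ m"
proof (induction m)
  case (Suc m)
  show ?case
  proof (cases "n = 0")
    case False
    have "(\<Sum>i<n ^ Suc m. \<Prod>j<Suc m. z (i div n ^ j mod n))
        = (\<Sum>i<n ^ m * n. z (i mod n) * (\<Prod>j<m. z (i div n div n ^ j mod n)))"
      by (simp add: prod.lessThan_Suc_shift div_mult2_eq mult.commute del: prod.lessThan_Suc)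
    also have "\<dots> = (\<Sum>q<n ^ m. \<Sum>i\<in>{q * n..<q * n + n}. z (i mod n) * (\<Prod>j<m. z (i div n div n ^ j mod n)))"
      by (rule sum.nat_group[symmetric])
    also have "\<dots> = (\<Sum>q<n ^ m. \<Sum>i<n. z i * (\<Prod>j<m. z (q div n ^ j mod n)))"
    proof (rule sum.cong[OF refl])
      fix q
      show "(\<Sum>i\<in>{q * n..<q * n + n}. z (i mod n) * (\<Prod>j<m. z (i div n div n ^ j mod n)))
          = (\<Sum>i<n. z i * (\<Prod>j<m. z (q div n ^ j mod n)))"
        by (simp add: sum.atLeastLessThan_shift_0[of _ "q * n"] atLeast0LessThan div_mult_self3)
    qed
    also have "\<dots> = (\<Sum>i<n. z i) * (\<Sum>q<n ^ m. \<Prod>j<m. z (q div n ^ j mod n))"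
      by (simp add: sum_distrib_right sum_distrib_left)
    finally show ?thesis using Suc.IH by simp
  qed simp
qed simp

lemma sum_lessThan_add:
  fixes f :: "nat \<Rightarrow> 'a :: comm_monoid_add"
  shows "(\<Sum>i<m + n. f i) = (\<Sum>i<m. f i) + (\<Sum>i<n. f (m + i))"
  by (induction n) (simp_all add: add.assoc)

lemma sum_sign_vectors:
  assumes "A \<subseteq> {..<n}" "B \<subseteq> {..<n}" "card A = k" "card B = k" "n = 2 * k"
  shows "(\<Sum>i<n. (if i \<in> A then 1 else - 1) * (if i \<in> B then 1 else - 1 :: real)) = 4 * real (card (A \<inter> B)) - n"
proof -
  have fin: "finite A" "finite B" using assms finite_subset by blast+
  have "(\<Sum>i<n. (if i \<in> A then 1 else - 1) * (if i \<in> B then 1 else - 1 :: real))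
     = (\<Sum>i<n. 1 - 2 * of_bool (i \<in> A) - 2 * of_bool (i \<in> B) + 4 * of_bool (i \<in> A \<inter> B))"
    by (intro sum.cong) auto
  also have "\<dots> = real n - 2 * (\<Sum>i<n. of_bool (i \<in> A)) - 2 * (\<Sum>i<n. of_bool (i \<in> B)) + 4 * (\<Sum>i<n. of_bool (i \<in> A \<inter> B))"
    by (simp only: sum.distrib sum_subtractf sum_distrib_left) simp
  also have "(\<Sum>i<n. of_bool (i \<in> A)) = real k"
    using assms by (simp add: sum_of_bool_eq Int_absorb1)
  also have "(\<Sum>i<n. of_bool (i \<in> B)) = real k"
    using assms by (simp add: sum_of_bool_eq Int_absorb1)
  also have "(\<Sum>i<n. of_bool (i \<in> A \<inter> B)) = real (card (A \<inter> B))"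
    using assms by (subst sum_of_bool_eq) (auto intro!: arg_cong[where f=card])
  finally show ?thesis using assms by simp
qed

text \<open>Inner products of concatenated blocks add up. The blocks are the scaled vector, its
  scaled tensor power and a constant; zeros fill the remaining coordinates up to
  \<open>d\<close>.\<close>

lemma tensor_feature_map:
  fixes x :: "'a \<Rightarrow> nat \<Rightarrow> real"
  assumes n: "n > 0" and d: "n ^ m + n + 1 \<le> d"
    and nonneg: "0 \<le> a" "0 \<le> b" "0 \<le> h"
  obtains \<phi> where
    "\<And>A. A \<in> X \<Longrightarrow> \<phi> A \<in> Rd d"
    "\<And>A. A \<in> X \<Longrightarrow> (\<Sum>i<d. (\<phi> A i)\<^sup>2) = a * (\<Sum>i<n. (x A i)\<^sup>2) + b * (\<Sum>i<n. (x A i)\<^sup>2) ^ m + h"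
    "\<And>A B. A \<in> X \<Longrightarrow> B \<in> X \<Longrightarrow> (\<Sum>i<d. \<phi> A i * \<phi> B i)
       = a * (\<Sum>i<n. x A i * x B i) + b * (\<Sum>i<n. x A i * x B i) ^ m + h"
proof -
  define \<phi> where "\<phi> A i = (if i < n then sqrt a * x A i
      else if i < n + n ^ m then sqrt b * (\<Prod>j<m. x A ((i - n) div n ^ j mod n))
      else if i = n + n ^ m then sqrt h else 0)" for A i
  have ip: "(\<Sum>i<d. \<phi> A i * \<phi> B i) = a * (\<Sum>i<n. x A i * x B i) + b * (\<Sum>i<n. x A i * x B i) ^ m + h" for A B
  proof -
    have "(\<Sum>i<d. \<phi> A i * \<phi> B i) = (\<Sum>i<n + n ^ m + 1. \<phi> A i * \<phi> B i)"
      using d by (intro sum.mono_neutral_right) (auto simp: \<phi>_def)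
    also have "\<dots> = (\<Sum>i<n + n ^ m. \<phi> A i * \<phi> B i) + h"
      using nonneg by (simp add: \<phi>_def)
    also have "(\<Sum>i<n + n ^ m. \<phi> A i * \<phi> B i) = (\<Sum>i<n. \<phi> A i * \<phi> B i) + (\<Sum>i<n ^ m. \<phi> A (n + i) * \<phi> B (n + i))"
      by (rule sum_lessThan_add)
    also have "(\<Sum>i<n. \<phi> A i * \<phi> B i) = a * (\<Sum>i<n. x A i * x B i)"
      using nonneg by (auto simp: \<phi>_def sum_distrib_left mult_ac intro!: sum.cong)
    also have "(\<Sum>i<n ^ m. \<phi> A (n + i) * \<phi> B (n + i))
       = (\<Sum>i<n ^ m. b * (\<Prod>j<m. x A (i div n ^ j mod n) * x B (i div n ^ j mod n)))"
      using nonneg by (intro sum.cong) (auto simp: \<phi>_def prod.distrib)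
    also have "\<dots> = b * (\<Sum>i<n. x A i * x B i) ^ m"
      by (simp only: sum_distrib_left[symmetric] sum_tensor_power[of "\<lambda>i. x A i * x B i"])
    finally show ?thesis .
  qed
  show ?thesis
  proof (rule that[of \<phi>])
    show "\<phi> A \<in> Rd d" for A using d by (auto simp: Rd_def \<phi>_def)
    show "(\<Sum>i<d. (\<phi> A i)\<^sup>2) = a * (\<Sum>i<n. (x A i)\<^sup>2) + b * (\<Sum>i<n. (x A i)\<^sup>2) ^ m + h" for A
      using ip[of A A] by (simp add: power2_eq_square)
  qed (rule ip)
qed

section \<open>The bound for fixed \<open>B\<close> and \<open>L\<close>\<close>

text \<open>The value of \<open>a\<close> solves \<open>g' (- u) = 0\<close> for
  \<open>g t = t + a * t ^ B\<close>. The hypothesis \<open>radius\<close> says that the image,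
  scaled to diameter 1, has norm at most \<open>r\<close> before the constant coordinate is
  added.\<close>

lemma f_r_lower_bound:
  fixes B L d :: nat and r :: real
  defines "u \<equiv> (real B - 1) / (real B + 1)" and "n \<equiv> 2 * (B + 1) * L"
  defines "a \<equiv> 1 / (real B * u ^ (B - 1))"
  assumes B: "B = 2 ^ b" "b \<ge> 1" and L: "L = 2 ^ c" and r: "r > 0"
    and radius: "1 + a \<le> 2 * r\<^sup>2 * (1 + a + u * (1 - 1 / real B))"
    and d: "n ^ B + n + 1 \<le> d"
  shows "((real B + 2) ^ (B + 2) * real B ^ B / (real B + 1) ^ (2 * B + 2)) ^ L / real n \<le> real (f_r r d)"
proof -
  define k where "k = (B + 1) * L"
  define g where "g t = t + a * t ^ B" for t
  \<comment> \<open>Squared distances will be \<open>2 * \<sigma> * (g 1 - g t)\<close>, so this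
    normalises the largest one to 1.\<close>
  define \<sigma> where "\<sigma> = 1 / (2 * (g 1 - g (- u)))"
  \<comment> \<open>The squared constant coordinate: what the squared norm
    \<open>\<sigma> * g 1\<close> lacks to reach \<open>r^2\<close>.\<close>
  define h where "h = r\<^sup>2 - \<sigma> * (1 + a)"
  define X where "X = {A. A \<subseteq> {..<n} \<and> card A = k}"
  define x where "x A i = (if i \<in> A then 1 else - 1 :: real)" for A :: "nat set" and i
  have B2: "B \<ge> 2" using B power_increasing[of 1 b "2::nat"] by simp
  have Lpos: "L > 0" by (simp add: L)
  have nk: "n = 2 * k" by (simp add: n_def k_def)
  have npos: "n > 0" "k > 0" using Lpos by (auto simp: n_def k_def)
  have evB: "even B" using B by simp
  have u: "u > 0" using B2 by (simp add: u_def)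
  have a: "a > 0" using u B2 by (simp add: a_def)
  have auB: "a * u ^ B = u / real B"
    using u B2 power_Suc[of u "B - 1"] by (simp add: a_def)
  have gu: "g (- u) = - (u * (1 - 1 / real B))"
    using evB auB by (simp add: g_def algebra_simps)
  \<comment> \<open>Bernoulli for even exponents holds at every real \<open>y\<close>; it is the
    tangent line at \<open>y = 1\<close>, that is \<open>t = - u\<close>, and
    \<open>a * u ^ B = u / B\<close> cancels the linear terms.\<close>
  have gmin: "g (- u) \<le> g t" for t
  proof -
    define y where "y = - t / u"
    have t: "t = - (u * y)" using u by (simp add: y_def)
    have "1 + real B * (y - 1) \<le> (1 + (y - 1)) ^ B" using evB by (rule Bernoulli_inequality_even)
    then have "(u / real B) * (1 + real B * (y - 1)) \<le> (u / real B) * y ^ B"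
      using u by (intro mult_left_mono) auto
    also have "\<dots> = a * t ^ B" unfolding auB[symmetric] t using evB by (simp add: power_mult_distrib)
    finally show ?thesis unfolding gu unfolding g_def t using B2 by (simp add: field_simps)
  qed
  have w: "u * (1 - 1 / real B) > 0" using u B2 by simp
  have \<sigma>: "\<sigma> > 0" using w a unfolding \<sigma>_def gu by (simp add: g_def)
  have \<sigma>_norm: "2 * \<sigma> * (g 1 - g (- u)) = 1" using w a unfolding \<sigma>_def gu by (simp add: g_def)
  have h: "h \<ge> 0"
  proof -
    have "\<sigma> * (1 + a) \<le> \<sigma> * (2 * r\<^sup>2 * (g 1 - g (- u)))"
      using radius \<sigma> unfolding gu by (intro mult_left_mono) (auto simp: g_def)
    also have "\<dots> = (2 * \<sigma> * (g 1 - g (- u))) * r\<^sup>2" by (simp only: mult_ac)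
    finally show ?thesis unfolding \<sigma>_norm h_def by simp
  qed
  have ipx: "(\<Sum>i<n. x A i * x B i) = 4 * real (card (A \<inter> B)) - n" if "A \<in> X" "B \<in> X" for A B
    using that unfolding x_def X_def by (intro sum_sign_vectors[OF _ _ _ _ nk]) auto
  \<comment> \<open>Sign vectors have inner product \<open>n * t\<close>, so these weights turn the
    kernel into \<open>\<sigma> * g t + h\<close>.\<close>
  have "0 \<le> \<sigma> / n" "0 \<le> \<sigma> * a / n ^ B" using \<sigma> a by auto
  from tensor_feature_map[OF npos(1) d this h, of X x]
  obtain \<phi> where \<phi>: "\<And>A. A \<in> X \<Longrightarrow> \<phi> A \<in> Rd d"
    "\<And>A. A \<in> X \<Longrightarrow> (\<Sum>i<d. (\<phi> A i)\<^sup>2) = \<sigma> / n * (\<Sum>i<n. (x A i)\<^sup>2) + \<sigma> * a / n ^ B * (\<Sum>i<n. (x A i)\<^sup>2) ^ B + h"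
    "\<And>A A'. A \<in> X \<Longrightarrow> A' \<in> X \<Longrightarrow> (\<Sum>i<d. \<phi> A i * \<phi> A' i)
       = \<sigma> / n * (\<Sum>i<n. x A i * x A' i) + \<sigma> * a / n ^ B * (\<Sum>i<n. x A i * x A' i) ^ B + h"
    by blast
  have nrm: "(\<Sum>i<d. (\<phi> A i)\<^sup>2) = \<sigma> * g 1 + h" if "A \<in> X" for A
  proof -
    have "(x A i)\<^sup>2 = 1" for i by (simp add: x_def)
    then have "(\<Sum>i<n. (x A i)\<^sup>2) = real n" by simp
    then show ?thesis using \<phi>(2)[OF that] npos by (simp add: g_def algebra_simps)
  qed
  have dist: "(edist d (\<phi> A) (\<phi> A'))\<^sup>2 = 2 * \<sigma> * (g 1 - g ((4 * real (card (A \<inter> A')) - n) / n))"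
    if "A \<in> X" "A' \<in> X" for A A'
  proof -
    define S where "S = 4 * real (card (A \<inter> A')) - n"
    have "(edist d (\<phi> A) (\<phi> A'))\<^sup>2 = (\<Sum>i<d. (\<phi> A i - \<phi> A' i)\<^sup>2)"
      unfolding edist_def by (simp add: sum_nonneg)
    also have "\<dots> = (\<Sum>i<d. (\<phi> A i)\<^sup>2) + (\<Sum>i<d. (\<phi> A' i)\<^sup>2) - 2 * (\<Sum>i<d. \<phi> A i * \<phi> A' i)"
      by (simp add: power2_diff sum.distrib sum_subtractf sum_distrib_left mult.assoc)
    also have "(\<Sum>i<d. \<phi> A i * \<phi> A' i) = \<sigma> * g (S / n) + h"
      using \<phi>(3)[OF that] unfolding ipx[OF that] S_def[symmetric] g_def
      by (simp add: power_divide algebra_simps)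
    finally show ?thesis using nrm that by (simp add: S_def algebra_simps)
  qed
  have le1: "edist d (\<phi> A) (\<phi> A') \<le> 1" if "A \<in> X" "A' \<in> X" for A A'
  proof -
    have "(edist d (\<phi> A) (\<phi> A'))\<^sup>2 \<le> 2 * \<sigma> * (g 1 - g (- u))"
      unfolding dist[OF that] using gmin \<sigma> by (intro mult_left_mono) auto
    then show ?thesis unfolding \<sigma>_norm using power2_le_imp_le[of _ "1::real"] by simp
  qed
  have eq1: "edist d (\<phi> A) (\<phi> A') = 1" if "A \<in> X" "A' \<in> X" "card (A \<inter> A') = L" for A A'
  proof -
    have "(4 * real L - n) / n = - u"
    proof -
      have "real n = (2 * real L) * (real B + 1)" "4 * real L - n = (2 * real L) * (1 - real B)"
        by (simp_all add: n_def algebra_simps)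
      then show ?thesis using Lpos by (simp add: u_def minus_divide_left)
    qed
    then have "(edist d (\<phi> A) (\<phi> A'))\<^sup>2 = 1" using dist[OF that(1,2)] that(3) \<sigma>_norm by simp
    moreover have "edist d (\<phi> A) (\<phi> A') \<ge> 0" by (simp add: edist_def sum_nonneg)
    ultimately show ?thesis by (simp add: power2_eq_1_iff)
  qed
  define D where "D = (\<Sum>j<B * L. n choose j)"
  have main: "card X \<le> f_r r d * D"
  proof (rule card_le_borsuk_num_mult[where \<phi> = \<phi>])
    show "finite X" unfolding X_def by (rule finite_subset[of _ "Pow {..<n}"]) auto
    have "(\<Sum>i<d. (\<phi> A i)\<^sup>2) = r\<^sup>2" if "A \<in> X" for A
      using nrm[OF that] by (simp add: h_def g_def)
    then show "\<phi> ` X \<subseteq> sphere_d d r" using \<phi>(1) r by (auto simp: sphere_d_def)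
    have Lk: "L \<le> k" by (simp add: k_def)
    \<comment> \<open>Two \<open>k\<close>-sets that share exactly \<open>L\<close> points, so the
      diameter 1 is attained.\<close>
    show X1: "{..<k} \<in> X" using nk by (auto simp: X_def)
    show X2: "{k - L..<2 * k - L} \<in> X" using nk Lk by (auto simp: X_def)
    have "{..<k} \<inter> {k - L..<2 * k - L} = {k - L..<k}" using Lk by auto
    then show "edist d (\<phi> {..<k}) (\<phi> {k - L..<2 * k - L}) = 1"
      using Lk by (intro eq1 X1 X2) simp
  next
    fix F assume F: "F \<subseteq> X" "\<And>A A'. A \<in> F \<Longrightarrow> A' \<in> F \<Longrightarrow> edist d (\<phi> A) (\<phi> A') \<noteq> 1"
    \<comment> \<open>Here \<open>q = B * L\<close> and \<open>l = L\<close>, matching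
      \<open>k = q + l\<close>; \<open>q\<close> is a power of two because \<open>B\<close> and
      \<open>L\<close> are.\<close>
    have "card F \<le> (\<Sum>j<B * L. card {..<n} choose j)"
    proof (rule forbidden_intersection_bound)
      show "B * L = 2 ^ (b + c)" by (simp add: B L power_add)
      show "L < B * L" using B2 Lpos by simp
      show "A \<subseteq> {..<n} \<and> card A = B * L + L" if "A \<in> F" for A
        using F(1) that by (auto simp: X_def k_def)
      show "card (A \<inter> A') \<noteq> L" if "A \<in> F" "A' \<in> F" for A A'
        using F that eq1 by blast
    qed simp
    then show "card F \<le> D" by (simp add: D_def)
  qed (rule le1)
  have cX: "card X = n choose k" unfolding X_def using n_subsets[of "{..<n}" k] by simp
  let ?\<gamma> = "(real B + 2) ^ (B + 2) * real B ^ B / (real B + 1) ^ (2 * B + 2)"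
  have D: "D > 0" unfolding D_def
  proof (rule sum_pos2[of _ 0])
    show "0 \<in> {..<B * L}" using B2 Lpos by simp
  qed auto
  have "?\<gamma> ^ L / real n * real D \<le> real (n choose k)"
    unfolding D_def n_def k_def using B2 Lpos by (intro central_binomial_ratio) auto
  also have "\<dots> \<le> real (f_r r d * D)" using main unfolding cX of_nat_le_iff .
  also have "\<dots> = real (f_r r d) * real D" by (rule of_nat_mult)
  finally show ?thesis by (rule mult_right_le_imp_le) (simp add: D)
qed

section \<open>Choice of parameters and asymptotics in the dimension\<close>

text \<open>As \<open>B\<close> grows, \<open>u B * (1 - 1 / B)\<close> tends to 1 and
  \<open>a\<close> to 0, so the condition tends to \<open>1 \<le> 4 * r^2\<close>, which is strict
  for \<open>r > 1 / 2\<close>.\<close>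

lemma exists_small_radius_parameter:
  fixes r :: real
  assumes "r > 1 / 2"
  defines "u \<equiv> \<lambda>B::nat. (real B - 1) / (real B + 1)"
  obtains b :: nat and B :: nat where "b \<ge> 1" "B = 2 ^ b"
    "1 + 1 / (real B * u B ^ (B - 1))
      \<le> 2 * r\<^sup>2 * (1 + 1 / (real B * u B ^ (B - 1)) + u B * (1 - 1 / real B))"
proof -
  define C where "C = \<bar>1 - 2 * r\<^sup>2\<bar>"
  have r: "4 * r\<^sup>2 > 1" using assms(1) power_strict_mono[of "1 / 2" r 2] by (simp add: power2_eq_square)
  \<comment> \<open>Right side minus left side of the goal, with the term
    \<open>(1 - 2 * r^2) * a\<close> replaced by its upper bound \<open>C * 9 / B\<close>;
    \<open>C\<close> is an absolute value because the sign of \<open>1 - 2 * r^2\<close> depends on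
    \<open>r\<close>.\<close>
  have "((\<lambda>B::nat. 2 * r\<^sup>2 * ((real B - 1) / (real B + 1) * (1 - 1 / real B)) - (1 - 2 * r\<^sup>2) - 9 / real B * C)
      \<longlongrightarrow> 2 * r\<^sup>2 * 1 - (1 - 2 * r\<^sup>2) - 0 * C) at_top"
    by (intro tendsto_intros; real_asymp)
  then have "\<forall>\<^sub>F B::nat in at_top. 2 * r\<^sup>2 * (u B * (1 - 1 / real B)) - (1 - 2 * r\<^sup>2) - 9 / real B * C > 0"
    unfolding u_def by (rule order_tendstoD) (use r in simp)
  then obtain b0 where b0: "\<And>B. B \<ge> b0 \<Longrightarrow> 2 * r\<^sup>2 * (u B * (1 - 1 / real B)) - (1 - 2 * r\<^sup>2) - 9 / real B * C > 0"
    unfolding eventually_at_top_linorder by blast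
  define b where "b = Suc b0"
  define B :: nat where "B = 2 ^ b"
  define a where "a = 1 / (real B * u B ^ (B - 1))"
  have B: "B \<ge> b0" "B \<ge> 2" using less_exp[of b] by (auto simp: B_def b_def)
  \<comment> \<open>Since \<open>1 / u B = 1 + 2 / (B - 1)\<close>, the power is at most
    \<open>exp 2\<close>, hence at most 9.\<close>
  have "(1 / u B) ^ (B - 1) = (1 + 2 / real (B - 1)) ^ (B - 1)"
    using B by (simp add: u_def of_nat_diff field_simps)
  also have "\<dots> \<le> exp 2" using B by (intro exp_ge_one_plus_x_over_n_power_n) auto
  also have "\<dots> = exp 1 ^ 2" by (simp flip: exp_of_nat_mult)
  also have "\<dots> \<le> (3::real) ^ 2" by (intro power_mono exp_le) auto
  finally have "(1 / u B) ^ (B - 1) / real B \<le> 9 / real B" by (intro divide_right_mono) auto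
  moreover have "a = (1 / u B) ^ (B - 1) / real B" by (simp add: a_def power_divide)
  ultimately have a9: "a \<le> 9 / real B" by simp
  have a0: "a \<ge> 0" using B by (simp add: a_def u_def)
  have "(1 - 2 * r\<^sup>2) * a \<le> C * a" using a0 by (intro mult_right_mono) (auto simp: C_def)
  also have "\<dots> \<le> C * (9 / real B)" using a9 by (intro mult_left_mono) (auto simp: C_def)
  finally have "1 + a \<le> 2 * r\<^sup>2 * (1 + a + u B * (1 - 1 / real B))"
    using b0[OF B(1)] by (simp add: algebra_simps)
  then show ?thesis using that[of b B] by (simp add: a_def B_def b_def)
qed

text \<open>Rounding \<open>L\<close> down to a power of two costs at most a factor 2.\<close>

lemma dyadic_floor:
  fixes y :: real
  assumes "y \<ge> 1"
  obtains c :: nat where "2 ^ c \<le> y" "y < 2 * 2 ^ c"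
proof -
  define c where "c = nat \<lfloor>log 2 y\<rfloor>"
  have "log 2 y \<ge> 0" using assms by simp
  then have c: "real c \<le> log 2 y" "log 2 y < real c + 1" unfolding c_def by linarith+
  have "2 powr real c \<le> 2 powr log 2 y" "2 powr log 2 y < 2 powr (real c + 1)" using c by auto
  then have "2 ^ c \<le> y" "y < 2 * 2 ^ c" using assms by (auto simp: powr_realpow powr_add)
  then show ?thesis by (rule that)
qed

text \<open>The witnesses are \<open>k = B\<close> and base 2. With
  \<open>z = d powr (1 / (B + 1))\<close> the previous bound is at least
  \<open>exp (\<mu> * z) / z\<close>, which eventually exceeds the target because
  \<open>1 / (2 * B) < 1 / (B + 1)\<close>.\<close>

theorem theorem2:
  fixes r :: real
  assumes "r > 1/2"
  shows "\<exists>(k::nat) (c::real) (\<delta>::nat \<Rightarrow> real).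
           k > 0 \<and> c > 1 \<and> \<delta> \<longlonglongrightarrow> 0 \<and>
           (\<forall>d::nat. d \<ge> 2 \<longrightarrow>
              real (f_r r d) \<ge> (c + \<delta> d) powr (real d powr (1 / (2 * real k))))"
proof -
  obtain b B :: nat where B: "b \<ge> 1" "B = 2 ^ b" and
    radius: "1 + 1 / (real B * ((real B - 1) / (real B + 1)) ^ (B - 1))
      \<le> 2 * r\<^sup>2 * (1 + 1 / (real B * ((real B - 1) / (real B + 1)) ^ (B - 1))
        + (real B - 1) / (real B + 1) * (1 - 1 / real B))"
    using exists_small_radius_parameter[OF assms] by metis
  have B2: "B \<ge> 2" using B power_increasing[of 1 b "2::nat"] by simp
  define \<gamma> where "\<gamma> = (real B + 2) ^ (B + 2) * real B ^ B / (real B + 1) ^ (2 * B + 2)"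
  \<comment> \<open>Chosen so that \<open>L \<le> \<kappa> * z\<close> gives
    \<open>n = 2 * (B + 1) * L \<le> z\<close>.\<close>
  define \<kappa> where "\<kappa> = 1 / (2 * (real B + 1))"
  \<comment> \<open>The exponent \<open>1 / (B + 1)\<close> instead of \<open>1 / B\<close> leaves
    room for \<open>n ^ B + n + 1 \<le> n ^ (B + 1) \<le> d\<close>.\<close>
  define z where "z d = real d powr (1 / (real B + 1))" for d
  have \<gamma>: "\<gamma> > 1" unfolding \<gamma>_def by (rule growth_rate_gt_1)
  have \<kappa>: "\<kappa> > 0" by (simp add: \<kappa>_def)
  \<comment> \<open>The division by 2 absorbs the dyadic rounding of \<open>L\<close>.\<close>
  define \<mu> where "\<mu> = ln \<gamma> * \<kappa> / 2"
  have \<mu>: "\<mu> > 0" using \<gamma> \<kappa> by (simp add: \<mu>_def)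
  have z: "filterlim z at_top sequentially"
    unfolding z_def by real_asymp
  have "\<forall>\<^sub>F z::real in at_top. 2 powr (z powr (3 / 4)) \<le> exp (\<mu> * z) / z"
    using \<mu> by real_asymp
  moreover have "\<forall>\<^sub>F z::real in at_top. \<kappa> * z \<ge> 1"
    using \<kappa> by real_asymp
  ultimately have "\<forall>\<^sub>F z::real in at_top. 2 powr (z powr (3 / 4)) \<le> exp (\<mu> * z) / z \<and> \<kappa> * z \<ge> 1"
    by (rule eventually_conj)
  from eventually_compose_filterlim[OF this z]
  have ev: "\<forall>\<^sub>F d in sequentially. real (f_r r d) \<ge> 2 powr (real d powr (1 / (2 * real B)))"
    using eventually_ge_at_top[of 1]
  proof eventually_elim
    case (elim d)
    obtain c where c: "2 ^ c \<le> \<kappa> * z d" "\<kappa> * z d < 2 * 2 ^ c"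
      using dyadic_floor elim by blast
    define L :: nat where "L = 2 ^ c"
    define n where "n = 2 * (B + 1) * L"
    have L: "real L \<le> \<kappa> * z d" "\<kappa> * z d / 2 \<le> real L" using c by (auto simp: L_def)
    have Lpos: "L > 0" by (simp add: L_def)
    have zpos: "z d > 0" using elim by (simp add: z_def)
    have n: "real n \<le> z d" using L(1) by (simp add: n_def \<kappa>_def field_simps)
    have "2 * (2 + 1) * 1 \<le> n" unfolding n_def using B2 Lpos by (intro mult_le_mono) auto
    then have n6: "n \<ge> 6" by simp
    have "real (n ^ (B + 1)) \<le> z d ^ (B + 1)" using n by (simp add: power_mono del: power_Suc)
    also have "\<dots> = real d"
      using elim by (simp add: z_def powr_power add.commute del: power_Suc)
    finally have "n ^ (B + 1) \<le> d" by linarith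
    moreover have "n ^ B + n + 1 \<le> n ^ (B + 1)"
    proof -
      have "n \<le> n ^ B" using n6 B2 power_increasing[of 1 B n] by simp
      moreover have "3 * n ^ B \<le> n * n ^ B" using n6 by (intro mult_right_mono) auto
      moreover have "n ^ (B + 1) = n * n ^ B" by simp
      ultimately show ?thesis using n6 by linarith
    qed
    ultimately have "n ^ B + n + 1 \<le> d" by linarith
    then have f: "\<gamma> ^ L / real n \<le> real (f_r r d)"
      unfolding \<gamma>_def n_def using assms by (intro f_r_lower_bound[OF B(2,1) L_def _ radius]) auto
    \<comment> \<open>The inequality \<open>1 / (2 * B) \<le> 3 / 4 * (1 / (B + 1))\<close> amounts
      to \<open>B \<ge> 2\<close>, with equality at \<open>B = 2\<close>.\<close>
    have "real d powr (1 / (2 * real B)) \<le> real d powr (3 / 4 * (1 / (real B + 1)))"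
      using elim B2 by (intro powr_mono) (auto simp: field_simps)
    also have "\<dots> = z d powr (3 / 4)" by (simp add: z_def powr_powr mult.commute)
    finally have "2 powr (real d powr (1 / (2 * real B))) \<le> 2 powr (z d powr (3 / 4))" by simp
    also have "\<dots> \<le> exp (\<mu> * z d) / z d" using elim by simp
    also have "\<dots> \<le> \<gamma> ^ L / real n"
    proof (intro frac_le)
      have "\<mu> * z d = ln \<gamma> * (\<kappa> * z d / 2)" by (simp add: \<mu>_def)
      also have "\<dots> \<le> ln \<gamma> * real L" using L(2) \<gamma> by (intro mult_left_mono) auto
      finally have "exp (\<mu> * z d) \<le> exp (real L * ln \<gamma>)" by (simp add: mult.commute)
      then show "exp (\<mu> * z d) \<le> \<gamma> ^ L" using \<gamma> by (simp add: exp_of_nat_mult)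
    qed (use n n6 \<gamma> in auto)
    finally show ?case using f by linarith
  qed
  \<comment> \<open>\<open>0 powr _ = 0\<close>, so \<open>\<delta> d = - 2\<close> makes the bound trivial for the finitely many bad \<open>d\<close>.\<close>
  define \<delta> where "\<delta> d = (if 2 powr (real d powr (1 / (2 * real B))) \<le> real (f_r r d) then 0 else - 2 :: real)" for d
  have "\<forall>\<^sub>F d in sequentially. \<delta> d = 0"
    using ev by eventually_elim (simp add: \<delta>_def)
  then have "\<delta> \<longlonglongrightarrow> 0" by (rule tendsto_eventually)
  moreover have "(2 + \<delta> d) powr (real d powr (1 / (2 * real B))) \<le> real (f_r r d)" for d
    by (simp add: \<delta>_def)
  ultimately show ?thesis using B2 by (intro exI[of _ B] exI[of _ 2] exI[of _ \<delta>]) auto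
qed

end
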